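(* Let $S(t)=\sum_{n\ge 0}s_n t^n$ be the generating function of directed plateau polycubes according to the lateral area, where $s_n$ is the number of directed plateau polycubes (of any width) of lateral area $n$. Then, as formal power series, $$S(t)=\frac{t^2(1-t)^2}{(1-t)^4-t^2}.$$
   Context: A cell is a unit cube of the lattice $\mathbb{Z}^3$ with orthonormal coordinate system $(0,\vec i,\vec j,\vec k)$. A polycube is a finite (nonempty) union of cells, connected through their faces, and considered up to translation. Its width is the difference between its greatest and smallest indices (coordinates of its points) in the direction $\vec i$, i.e. the number of layers of cells it occupies in direction $\vec i$. A stratum is a polycube of width $1$; a plateau is a rectangular stratum (a full $1\times b\times c$ block of cells, of extent $1$ in direction $\vec i$). A plateau polycube is a polycube whose strata (its intersections with the successive unit-width layers orthogonal to $\vec i$) are all plateaus. A polycube is directed if each of its cells can be reached from a distinguished cell of the polycube, called the root, by a path inside the polycube made only of East (one unit in direction $\vec i$), North (one unit in direction $\vec j$) and Ahead (one unit in direction $\vec k$) steps. A directed plateau polycube is a plateau polycube that is directed. The lateral area of a polycube is the sum of the areas (numbers of unit squares) of its projections onto the planes $(\vec i,\vec j)$ and $(\vec i,\vec k)$. *)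

theory Defs
  imports "HOL-Library.Product_Plus" "HOL-Computational_Algebra.Formal_Power_Series"
begin

text \<open>
  The triple \<open>(x, y, z)\<close> stands for the unit cube
  \<open>[x, x + 1] \<times> [y, y + 1] \<times> [z, z + 1]\<close>, the coordinates being those along
  \<open>i\<close>, \<open>j\<close>, \<open>k\<close> respectively.
\<close>

type_synonym cell = "int \<times> int \<times> int"

definition east :: cell where "east = (1, 0, 0)"
definition north :: cell where "north = (0, 1, 0)"
definition ahead :: cell where "ahead = (0, 0, 1)"

definition directed_step :: "cell set \<Rightarrow> (cell \<times> cell) set" where
  "directed_step P = {(c, d). c \<in> P \<and> d \<in> P \<and> d - c \<in> {east, north, ahead}}"

text \<open>Two unit cubes share a face iff they differ by a unit vector, in either orientation.\<close>

definition face_adjacent :: "cell set \<Rightarrow> (cell \<times> cell) set" where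
  "face_adjacent P = directed_step P \<union> (directed_step P)\<inverse>"

text \<open>
  This is a polycube at a fixed position in the lattice; polycubes up to translation are the
  classes of \<open>translation_rel\<close> below.
\<close>

definition polycube :: "cell set \<Rightarrow> bool" where
  "polycube P \<longleftrightarrow> finite P \<and> P \<noteq> {} \<and> (\<forall>c\<in>P. \<forall>d\<in>P. (c, d) \<in> (face_adjacent P)\<^sup>*)"

text \<open>
  The \<open>+ 1\<close> is there because the cubes of the last layer reach up to abscissa
  \<open>Max (fst ` P) + 1\<close>.
\<close>

definition width :: "cell set \<Rightarrow> int" where
  "width P = Max (fst ` P) + 1 - Min (fst ` P)"

definition stratum :: "cell set \<Rightarrow> bool" where
  "stratum A \<longleftrightarrow> polycube A \<and> width A = 1"

definition plateau :: "cell set \<Rightarrow> bool" where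
  "plateau A \<longleftrightarrow> stratum A \<and> (\<exists>x y y' z z'. A = {x} \<times> {y..y'} \<times> {z..z'})"

definition layer :: "cell set \<Rightarrow> int \<Rightarrow> cell set" where
  "layer P x = {c \<in> P. fst c = x}"

definition plateau_polycube :: "cell set \<Rightarrow> bool" where
  "plateau_polycube P \<longleftrightarrow> polycube P \<and> (\<forall>x \<in> fst ` P. plateau (layer P x))"

definition directed :: "cell set \<Rightarrow> bool" where
  "directed P \<longleftrightarrow> (\<exists>root\<in>P. \<forall>c\<in>P. (root, c) \<in> (directed_step P)\<^sup>*)"

definition directed_plateau_polycube :: "cell set \<Rightarrow> bool" where
  "directed_plateau_polycube P \<longleftrightarrow> plateau_polycube P \<and> directed P"

definition lateral_area :: "cell set \<Rightarrow> nat" where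
  "lateral_area P = card ((\<lambda>(x, y, z). (x, y)) ` P) + card ((\<lambda>(x, y, z). (x, z)) ` P)"

definition translation_rel :: "(cell set \<times> cell set) set" where
  "translation_rel = {(P, Q). \<exists>v. Q = (\<lambda>c. c + v) ` P}"

definition directed_plateau_count :: "nat \<Rightarrow> nat" where
  "directed_plateau_count n =
     card ({P. directed_plateau_polycube P \<and> lateral_area P = n} // translation_rel)"

definition directed_plateau_gf :: "rat fps" where
  "directed_plateau_gf = Abs_fps (\<lambda>n. of_nat (directed_plateau_count n))"

end

theory Submission imports Defs begin

text \<open>
  A directed plateau polycube is a stack of rectangles, one per layer, and directedness becomes a
  condition on consecutive layers only. The corner of a layer with least \<open>y\<close> and \<open>z\<close> cannot be
  entered from its own layer; in every layer but the first it is entered by an East step, so its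
  western neighbour lies in the previous rectangle. Conversely, if these neighbours do lie there,
  every cell is reached from the corner of the first layer. A rectangle of size \<open>b \<times> c\<close> thus leaves
  \<open>b c\<close> positions for its successor, whatever the size of the successor.

  The lateral area is the sum of the half-perimeters \<open>b + c\<close> of the rectangles. With
  \<open>A = \<Sum> t\<^bsup>b + c\<^esup> = t\<^sup>2 / (1 - t)\<^sup>2\<close> for the last layer and
  \<open>B = \<Sum> b c t\<^bsup>b + c\<^esup> = t\<^sup>2 / (1 - t)\<^sup>4\<close> for each of the others, cutting off the first layer
  gives \<open>S = A + B S\<close>, and the claim follows.

  To make the product \<open>B S\<close> literal, polycubes are encoded by the free datatype \<open>plan\<close>. In a layer
  that is not the last, the corner of the next layer cuts the side \<open>b\<close> as \<open>b = p + 1 + p'\<close>, with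
  \<open>p\<close> cells before and \<open>p'\<close> cells after it, and likewise \<open>c = q + 1 + q'\<close>. The numbers
  \<open>p, p', q, q'\<close> are arbitrary, so that \<open>B\<close> counts quadruples of naturals. The function \<open>build\<close>
  turns a plan into a polycube with a given root. It is injective and commutes with translations
  (\<open>build_inj\<close>, \<open>build_eq_corner\<close>, \<open>translate_build\<close>), and it reaches every directed plateau
  polycube (\<open>directed_plateaus_built\<close>); hence plans of weight \<open>n\<close> are in bijection with the
  translation classes of area \<open>n\<close> (\<open>directed_plateau_count_weight\<close>).
\<close>

section \<open>Plans of directed plateau polycubes\<close>

text \<open>
  The extents are \<open>m + 1\<close> and \<open>n + 1\<close>, so that all naturals are admissible and every block is
  nonempty.
\<close>

definition block :: "int \<Rightarrow> int \<Rightarrow> int \<Rightarrow> nat \<Rightarrow> nat \<Rightarrow> cell set" where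
  "block x y z m n = {x} \<times> {y..y + int m} \<times> {z..z + int n}"

lemma mem_block: "(a, b, c) \<in> block x y z m n \<longleftrightarrow>
    a = x \<and> y \<le> b \<and> b \<le> y + int m \<and> z \<le> c \<and> c \<le> z + int n"
  by (auto simp: block_def)

text \<open>
  \<open>Then p p' q q' r\<close> is a layer followed by the plan \<open>r\<close>, whose root is the eastern neighbour of
  the cell at offset \<open>(p, q)\<close> in that layer.
\<close>

datatype plan = Last nat nat | Then nat nat nat nat plan

fun build :: "int \<Rightarrow> int \<Rightarrow> int \<Rightarrow> plan \<Rightarrow> cell set" where
  "build x y z (Last m n) = block x y z m n"
| "build x y z (Then p p' q q' r) =
     block x y z (p + p') (q + q') \<union> build (x + 1) (y + int p) (z + int q) r"

text \<open>Each layer contributes its half-perimeter; the \<open>2\<close> is due to the extents \<open>m + 1\<close>, \<open>n + 1\<close>.\<close>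

fun weight :: "plan \<Rightarrow> nat" where
  "weight (Last m n) = m + n + 2"
| "weight (Then p p' q q' r) = (p + p') + (q + q') + 2 + weight r"

section \<open>Directed reachability\<close>

lemma directed_step_iff: "((a, b, c), (a', b', c')) \<in> directed_step P \<longleftrightarrow>
    (a, b, c) \<in> P \<and> (a', b', c') \<in> P \<and>
    ((a', b', c') = (a + 1, b, c) \<or> (a', b', c') = (a, b + 1, c) \<or> (a', b', c') = (a, b, c + 1))"
  by (auto simp: directed_step_def east_def north_def ahead_def)

lemma directed_step_mono: "P \<subseteq> Q \<Longrightarrow> (directed_step P)\<^sup>* \<subseteq> (directed_step Q)\<^sup>*"
  by (rule rtrancl_mono) (auto simp: directed_step_def)

text \<open>
  Steps never decrease a coordinate. So the root of a directed polycube is its componentwise least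
  cell, which makes it unique.
\<close>

lemma reach_ge:
  assumes "((x, y, z), (a, b, c)) \<in> (directed_step P)\<^sup>*"
  shows "x \<le> a \<and> y \<le> b \<and> z \<le> c"
  using assms by (induction rule: rtrancl_induct[of "(x, y, z)" "(a, b, c)", split_format (complete)])
    (auto simp: directed_step_iff)

text \<open>Any two cells are connected through the root, walking one of the two paths backwards.\<close>

lemma directed_polycube:
  assumes "finite P" and "r \<in> P" and reach: "\<And>c. c \<in> P \<Longrightarrow> (r, c) \<in> (directed_step P)\<^sup>*"
  shows "polycube P"
  unfolding polycube_def
proof (intro conjI ballI)
  fix c d assume "c \<in> P" "d \<in> P"
  have sub: "(directed_step P)\<^sup>* \<subseteq> (face_adjacent P)\<^sup>*"
    by (rule rtrancl_mono) (auto simp: face_adjacent_def)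
  have "sym (face_adjacent P)" by (auto simp: face_adjacent_def sym_def)
  then have "sym ((face_adjacent P)\<^sup>*)" by (rule sym_rtrancl)
  moreover have "(r, c) \<in> (face_adjacent P)\<^sup>*" using reach \<open>c \<in> P\<close> sub by blast
  ultimately have "(c, r) \<in> (face_adjacent P)\<^sup>*" by (auto dest: symD)
  moreover have "(r, d) \<in> (face_adjacent P)\<^sup>*" using reach \<open>d \<in> P\<close> sub by blast
  ultimately show "(c, d) \<in> (face_adjacent P)\<^sup>*" by (rule rtrancl_trans)
qed (use assms in auto)

lemma block_reach:
  assumes "(a, b, c) \<in> block x y z m n" "block x y z m n \<subseteq> P"
  shows "((x, y, z), (a, b, c)) \<in> (directed_step P)\<^sup>*"
proof -
  have cells: "(x, y + int i, z + int j) \<in> P" if "i \<le> m" "j \<le> n" for i j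
    using assms(2) that by (auto simp: mem_block intro!: subsetD[OF assms(2)])
  \<comment> \<open>Go north along the near edge of the block, then ahead.\<close>
  have 1: "((x, y, z), (x, y + int i, z)) \<in> (directed_step P)\<^sup>*" if "i \<le> m" for i
    using that
  proof (induction i)
    case (Suc i)
    have "((x, y + int i, z), (x, y + int (Suc i), z)) \<in> directed_step P"
      using cells[of i 0] cells[of "Suc i" 0] Suc.prems by (simp add: directed_step_iff algebra_simps)
    with Suc show ?case by (auto intro: rtrancl_into_rtrancl)
  qed simp
  have 2: "((x, y + int i, z), (x, y + int i, z + int j)) \<in> (directed_step P)\<^sup>*"
    if "i \<le> m" "j \<le> n" for i j
    using that
  proof (induction j)
    case (Suc j)
    have "((x, y + int i, z + int j), (x, y + int i, z + int (Suc j))) \<in> directed_step P"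
      using cells[of i j] cells[of i "Suc j"] Suc.prems by (simp add: directed_step_iff algebra_simps)
    with Suc show ?case by (auto intro: rtrancl_into_rtrancl)
  qed simp
  obtain i j where "a = x" "b = y + int i" "c = z + int j" "i \<le> m" "j \<le> n"
    using assms(1) unfolding mem_block
    by (metis add_le_cancel_left of_nat_le_iff zle_iff_zadd)
  with 1 2 show ?thesis by (metis rtrancl_trans)
qed

section \<open>Every plan gives a directed plateau polycube\<close>

lemma finite_block [simp]: "finite (block x y z m n)"
  by (simp add: block_def)

lemma finite_build: "finite (build x y z r)"
  by (induction r arbitrary: x y z) auto

lemma corner_in_block: "(x, y, z) \<in> block x y z m n"
  by (simp add: mem_block)

lemma corner_in_build: "(x, y, z) \<in> build x y z r"
  by (cases r) (auto simp: corner_in_block)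

text \<open>
  A cell beyond the first layer is reached by walking to the western neighbour of the root of the rest,
  stepping east, and continuing inside the rest.
\<close>

lemma build_reach:
  "(a, b, c) \<in> build x y z r \<Longrightarrow> ((x, y, z), (a, b, c)) \<in> (directed_step (build x y z r))\<^sup>*"
proof (induction r arbitrary: x y z)
  case (Last m n)
  then show ?case by (auto intro: block_reach)
next
  case (Then p p' q q' r)
  let ?P = "build x y z (Then p p' q q' r)"
  let ?v = "(x + 1, y + int p, z + int q)"
  show ?case
  proof (cases "(a, b, c) \<in> block x y z (p + p') (q + q')")
    case True
    then show ?thesis by (rule block_reach) auto
  next
    case False
    with Then.prems have "(a, b, c) \<in> build (x + 1) (y + int p) (z + int q) r" by simp
    with Then.IH have "(?v, (a, b, c)) \<in> (directed_step (build (x + 1) (y + int p) (z + int q) r))\<^sup>*"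
      by blast
    then have 3: "(?v, (a, b, c)) \<in> (directed_step ?P)\<^sup>*"
      by (rule set_mp[OF directed_step_mono, rotated]) auto
    have m: "(x, y + int p, z + int q) \<in> block x y z (p + p') (q + q')"
      by (simp add: mem_block)
    have 1: "((x, y, z), (x, y + int p, z + int q)) \<in> (directed_step ?P)\<^sup>*"
      by (rule block_reach[OF m]) auto
    have "((x, y + int p, z + int q), ?v) \<in> directed_step ?P"
      using m corner_in_build by (simp add: directed_step_iff)
    with 1 3 show ?thesis by (meson rtrancl_into_rtrancl rtrancl_trans)
  qed
qed

lemma build_ge: "(a, b, c) \<in> build x y z r \<Longrightarrow> x \<le> a \<and> y \<le> b \<and> z \<le> c"
  by (rule reach_ge[OF build_reach])

lemma block_plateau: "plateau (block x y z m n)"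
proof -
  have "polycube (block x y z m n)"
    by (rule directed_polycube[OF finite_block corner_in_block])
      (auto intro: block_reach)
  moreover have "fst ` block x y z m n = {x}" by (auto simp: block_def)
  moreover have "\<exists>x' y1 y2 z1 z2. block x y z m n = {x'} \<times> {y1..y2} \<times> {z1..z2}"
    unfolding block_def by blast
  ultimately show ?thesis by (simp add: plateau_def stratum_def width_def)
qed

lemma layer_build_first:
  "layer (build x y z (Last m n)) x = block x y z m n"
  "layer (build x y z (Then p p' q q' r)) x = block x y z (p + p') (q + q')"
  by (auto simp: layer_def mem_block dest: build_ge)

lemma build_layers: "a \<in> fst ` build x y z r \<Longrightarrow> plateau (layer (build x y z r) a)"
proof (induction r arbitrary: x y z)
  case (Last m n)
  then have "a = x" by (auto simp: mem_block)
  then show ?case by (simp add: layer_build_first block_plateau del: build.simps)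
next
  case (Then p p' q q' r)
  show ?case
  proof (cases "a = x")
    case True
    then show ?thesis by (simp add: layer_build_first block_plateau del: build.simps)
  next
    case False
    then have "layer (build x y z (Then p p' q q' r)) a =
        layer (build (x + 1) (y + int p) (z + int q) r) a"
      by (auto simp: layer_def mem_block)
    moreover have "a \<in> fst ` build (x + 1) (y + int p) (z + int q) r"
      using False Then.prems by (auto simp: mem_block)
    ultimately show ?thesis using Then.IH by simp
  qed
qed

lemma build_directed_plateau_polycube: "directed_plateau_polycube (build x y z r)"
  unfolding directed_plateau_polycube_def plateau_polycube_def directed_def
  using directed_polycube[OF finite_build corner_in_build] build_layers build_reach corner_in_build
  by (metis prod_cases3)

section \<open>The lateral area of a plan\<close>

text \<open>Both projections keep the first coordinate, so distinct layers have disjoint projections.\<close>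

lemma lateral_area_Un:
  assumes "finite P" "finite Q" "fst ` P \<inter> fst ` Q = {}"
  shows "lateral_area (P \<union> Q) = lateral_area P + lateral_area Q"
proof -
  have *: "card (f ` (P \<union> Q)) = card (f ` P) + card (f ` Q)"
    if "\<And>c. fst (f c) = fst c" for f :: "cell \<Rightarrow> int \<times> int"
  proof -
    have "fst ` f ` A = fst ` A" for A by (simp add: image_image that)
    then have "f ` P \<inter> f ` Q = {}" using assms(3) by (metis (no_types) disjoint_iff imageI)
    then show ?thesis using assms by (simp add: image_Un card_Un_disjoint)
  qed
  show ?thesis unfolding lateral_area_def by (simp add: * split_beta)
qed

lemma lateral_area_block: "lateral_area (block x y z m n) = m + n + 2"
proof -
  have "(\<lambda>(x, y, z). (x, y)) ` ({x} \<times> B \<times> C) = {x} \<times> B" if "C \<noteq> {}" for B C :: "int set"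
    using that by force
  moreover have "(\<lambda>(x, y, z). (x, z)) ` ({x} \<times> B \<times> C) = {x} \<times> C" if "B \<noteq> {}" for B C :: "int set"
    using that by force
  ultimately show ?thesis by (simp add: lateral_area_def block_def card_cartesian_product)
qed

lemma lateral_area_build: "lateral_area (build x y z r) = weight r"
proof (induction r arbitrary: x y z)
  case (Then p p' q q' r)
  have "a = x" if "(a, b, c) \<in> block x y z (p + p') (q + q')" for a b c
    using that by (simp add: mem_block)
  moreover have "x + 1 \<le> a" if "(a, b, c) \<in> build (x + 1) (y + int p) (z + int q) r" for a b c
    using build_ge[OF that] by simp
  ultimately have "fst ` block x y z (p + p') (q + q') \<inter>
      fst ` build (x + 1) (y + int p) (z + int q) r = {}"
    by fastforce
  from lateral_area_Un[OF finite_block finite_build this] show ?case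
    by (simp only: build.simps weight.simps lateral_area_block Then.IH)
qed (simp add: lateral_area_block)

section \<open>A polycube determines its root and its plan\<close>

lemma translate_block:
  "(\<lambda>c. c + (u, v, w)) ` block x y z m n = block (x + u) (y + v) (z + w) m n"
proof (intro equalityI subsetI)
  fix d assume "d \<in> block (x + u) (y + v) (z + w) m n"
  then have "d - (u, v, w) \<in> block x y z m n"
    by (cases d) (auto simp: mem_block)
  then have "d - (u, v, w) + (u, v, w) \<in> (\<lambda>c. c + (u, v, w)) ` block x y z m n"
    by (rule imageI)
  then show "d \<in> (\<lambda>c. c + (u, v, w)) ` block x y z m n"
    by (simp only: diff_add_cancel)
qed (auto simp: mem_block)

lemma translate_build:
  "(\<lambda>c. c + (u, v, w)) ` build x y z r = build (x + u) (y + v) (z + w) r"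
proof (induction r arbitrary: x y z)
  case (Last m n)
  then show ?case by (simp add: translate_block)
next
  case (Then p p' q q' r)
  have "x + 1 + u = x + u + 1" "y + int p + v = y + v + int p" "z + int q + w = z + w + int q"
    by simp_all
  then show ?case by (simp only: build.simps image_Un translate_block Then.IH)
qed

lemma build_eq_corner:
  assumes "build x y z r = build x' y' z' r'"
  shows "x = x' \<and> y = y' \<and> z = z'"
  using build_ge[of x y z x' y' z' r'] build_ge[of x' y' z' x y z r]
    corner_in_build[of x y z r] corner_in_build[of x' y' z' r'] assms by auto

lemma block_eq: "block x y z m n = block x y z m' n' \<longleftrightarrow> m = m' \<and> n = n'"
  unfolding block_def by (auto simp: times_eq_iff)

lemma build_minus_layer:
  "build x y z (Last m n) - layer (build x y z (Last m n)) x = {}"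
  "build x y z (Then p p' q q' r) - layer (build x y z (Then p p' q q' r)) x =
     build (x + 1) (y + int p) (z + int q) r"
  by (auto simp: layer_def mem_block dest: build_ge)

text \<open>
  The first layer gives the sums \<open>p + p'\<close> and \<open>q + q'\<close>; the rest gives its own root, hence \<open>p\<close> and
  \<open>q\<close>, and by induction its plan.
\<close>

lemma build_inj: "build x y z r = build x y z r' \<Longrightarrow> r = r'"
proof (induction r arbitrary: x y z r')
  case (Last m n)
  note eq = Last.prems
  show ?case
  proof (cases r')
    case (Last m' n')
    then show ?thesis using eq by (simp add: block_eq)
  next
    case (Then p p' q q' s)
    have "build (x + 1) (y + int p) (z + int q) s = {}"
      using eq build_minus_layer Then by metis
    then show ?thesis using corner_in_build by blast
  qed
next
  case (Then p p' q q' r)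
  note eq = Then.prems and IH = Then.IH
  show ?case
  proof (cases r')
    case (Last m n)
    have "build (x + 1) (y + int p) (z + int q) r = {}"
      using eq build_minus_layer Last by metis
    then show ?thesis using corner_in_build by blast
  next
    case (Then s s' t t' r'')
    have rest: "build (x + 1) (y + int p) (z + int q) r = build (x + 1) (y + int s) (z + int t) r''"
      using eq build_minus_layer(2) unfolding Then by metis
    then have "p = s" "q = t" by (auto dest: build_eq_corner)
    moreover have "r = r''" using rest IH calculation by blast
    moreover have "block x y z (p + p') (q + q') = block x y z (s + s') (t + t')"
      using eq layer_build_first(2) unfolding Then by metis
    ultimately show ?thesis using Then by (simp add: block_eq)
  qed
qed

section \<open>Every directed plateau polycube has a plan\<close>

text \<open>A path moves east by one unit at a time, so it cannot skip the layer after that of its start.\<close>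

lemma reach_next_layer:
  assumes "((x, y, z), (a, b, c)) \<in> (directed_step P)\<^sup>*" "a \<noteq> x"
  shows "x + 1 \<in> fst ` P"
  using assms
proof (induction rule: rtrancl_induct[of "(x, y, z)" "(a, b, c)", split_format (complete)])
  case (step a b c a' b' c')
  then show ?case by (cases "a = x") (force simp: directed_step_iff)+
qed simp

lemma plateau_block:
  assumes "plateau (layer P x)"
  obtains y z m n where "layer P x = block x y z m n"
proof -
  obtain x' y y' z z' where eq: "layer P x = {x'} \<times> {y..y'} \<times> {z..z'}"
    using assms unfolding plateau_def by blast
  have "layer P x \<noteq> {}" using assms by (simp add: plateau_def stratum_def polycube_def)
  then have "y \<le> y'" "z \<le> z'" using eq by auto
  moreover from this have "(x', y, z) \<in> layer P x" unfolding eq by simp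
  then have "x' = x" by (simp add: layer_def)
  ultimately have "layer P x = block x y z (nat (y' - y)) (nat (z' - z))"
    by (simp add: eq block_def)
  then show ?thesis by (rule that)
qed

lemma mem_layer_block:
  assumes "layer P x = block x y z m n"
  shows "(x, b, c) \<in> P \<longleftrightarrow> y \<le> b \<and> b \<le> y + int m \<and> z \<le> c \<and> c \<le> z + int n"
proof -
  have "(x, b, c) \<in> P \<longleftrightarrow> (x, b, c) \<in> layer P x" by (simp add: layer_def)
  then show ?thesis by (simp add: assms mem_block)
qed

text \<open>
  Induction by removing the first layer. What remains is again directed, with root the least corner
  of the second layer: a path from the old root enters the rest through a cell of the second layer,
  and the new root reaches all cells of that layer. The new root itself can only be entered from the
  first layer, which yields the offset \<open>(p, q)\<close>.
\<close>

lemma directed_plateaus_built: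
  assumes "finite P" "(x, y, z) \<in> P"
    and reach: "\<And>c. c \<in> P \<Longrightarrow> ((x, y, z), c) \<in> (directed_step P)\<^sup>*"
    and plat: "\<And>a. a \<in> fst ` P \<Longrightarrow> plateau (layer P a)"
  shows "\<exists>r. P = build x y z r"
  using assms
proof (induction "card P" arbitrary: P x y z rule: less_induct)
  case less
  note reach = less.prems(3)
  have inP: "x \<in> fst ` P" using less.prems(2) by force
  obtain y0 z0 m n where L0: "layer P x = block x y0 z0 m n"
    using plateau_block less.prems(4)[OF inP] by blast
  have "(x, y0, z0) \<in> P" by (simp add: mem_layer_block[OF L0])
  then have "y \<le> y0 \<and> z \<le> z0" using reach_ge[OF reach] by blast
  with less.prems(2) have "y0 = y" "z0 = z" by (simp_all add: mem_layer_block[OF L0])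
  with L0 have L: "layer P x = block x y z m n" by simp
  define Q where "Q = P - layer P x"
  have PQ: "P = block x y z m n \<union> Q" using L by (auto simp: Q_def layer_def)
  show ?case
  proof (cases "Q = {}")
    case True
    then have "P = build x y z (Last m n)" using PQ by simp
    then show ?thesis by blast
  next
    case False
    then obtain d where "d \<in> Q" by blast
    then obtain a b c where "(a, b, c) \<in> P" "a \<noteq> x"
      by (cases d) (auto simp: Q_def layer_def)
    then have "x + 1 \<in> fst ` P" using reach_next_layer[OF reach] by blast
    then obtain y' z' m' n' where L': "layer P (x + 1) = block (x + 1) y' z' m' n'"
      using plateau_block less.prems(4) by blast
    let ?w = "(x + 1, y', z')"
    have w: "?w \<in> P" by (simp add: mem_layer_block[OF L'])
    then have wQ: "?w \<in> Q" by (simp add: Q_def layer_def)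
    have not: "(x + 1, y' - 1, z') \<notin> P" "(x + 1, y', z' - 1) \<notin> P"
      by (simp_all add: mem_layer_block[OF L'])
    have "(x, y', z') \<in> P"
    proof -
      have "((x, y, z), ?w) \<in> (directed_step P)\<^sup>*" using reach w by blast
      then obtain a b c where "((a, b, c), ?w) \<in> directed_step P"
        by (cases rule: rtranclE) auto
      then have "(a, b, c) \<in> P"
        "(a, b, c) = (x, y', z') \<or> (a, b, c) = (x + 1, y' - 1, z') \<or> (a, b, c) = (x + 1, y', z' - 1)"
        by (auto simp: directed_step_iff)
      with not show ?thesis by auto
    qed
    then have "y \<le> y'" "y' \<le> y + int m" "z \<le> z'" "z' \<le> z + int n"
      by (simp_all add: mem_layer_block[OF L])
    then obtain p p' q q' where pq: "y' = y + int p" "m = p + p'" "z' = z + int q" "n = q + q'"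
      by (intro that[of "nat (y' - y)" "m - nat (y' - y)" "nat (z' - z)" "n - nat (z' - z)"]) auto
    have reachQ: "(a, b, c) \<in> Q \<longrightarrow> (?w, (a, b, c)) \<in> (directed_step Q)\<^sup>*"
      if "((x, y, z), (a, b, c)) \<in> (directed_step P)\<^sup>*" for a b c
      using that
    proof (induction rule: rtrancl_induct[of "(x, y, z)" "(a, b, c)", split_format (complete)])
      case base
      then show ?case by (simp add: Q_def layer_def less.prems(2))
    next
      case (step a b c a' b' c')
      show ?case
      proof
        assume Q': "(a', b', c') \<in> Q"
        show "(?w, (a', b', c')) \<in> (directed_step Q)\<^sup>*"
        proof (cases "(a, b, c) \<in> Q")
          case True
          then have "((a, b, c), (a', b', c')) \<in> directed_step Q"
            using step Q' by (auto simp: directed_step_iff)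
          with True step show ?thesis by (auto intro: rtrancl_into_rtrancl)
        next
          case False
          then have "a = x" using step(2) by (auto simp: Q_def layer_def directed_step_iff)
          moreover have "a' \<noteq> x" using Q' by (auto simp: Q_def layer_def)
          ultimately have "(a', b', c') \<in> layer P (x + 1)"
            using step(2) by (auto simp: layer_def directed_step_iff)
          moreover have "layer P (x + 1) \<subseteq> Q" by (auto simp: Q_def layer_def)
          ultimately show ?thesis unfolding L' by (rule block_reach)
        qed
      qed
    qed
    have "\<exists>r. Q = build (x + 1) y' z' r"
    proof (rule less.hyps)
      have "(x, y, z) \<notin> Q" by (simp add: Q_def layer_def)
      then have "Q \<subset> P" using less.prems(2) by (auto simp: Q_def)
      then show "card Q < card P" using less.prems(1) by (rule psubset_card_mono[rotated])
      show "finite Q" using less.prems by (simp add: Q_def)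
      show "(x + 1, y', z') \<in> Q" by (rule wQ)
      show "(?w, c) \<in> (directed_step Q)\<^sup>*" if "c \<in> Q" for c
        using that reachQ reach by (cases c) (auto simp: Q_def)
      show "plateau (layer Q a)" if "a \<in> fst ` Q" for a
      proof -
        have "a \<noteq> x" "a \<in> fst ` P" using that by (auto simp: Q_def layer_def)
        moreover from this have "layer Q a = layer P a" by (auto simp: Q_def layer_def)
        ultimately show ?thesis using less.prems(4) by simp
      qed
    qed
    then obtain r where "Q = build (x + 1) y' z' r" by blast
    then have "P = build x y z (Then p p' q q' r)" using PQ pq by simp
    then show ?thesis by blast
  qed
qed

lemma directed_plateau_polycube_built:
  assumes "directed_plateau_polycube P"
  obtains x y z r where "P = build x y z r"
proof -
  obtain v where v: "v \<in> P" "\<And>c. c \<in> P \<Longrightarrow> (v, c) \<in> (directed_step P)\<^sup>*"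
    using assms unfolding directed_plateau_polycube_def directed_def by blast
  obtain x y z where v_eq: "v = (x, y, z)" by (rule prod_cases3)
  have "finite P" "\<And>a. a \<in> fst ` P \<Longrightarrow> plateau (layer P a)"
    using assms by (auto simp: directed_plateau_polycube_def plateau_polycube_def polycube_def)
  with v have "\<exists>r. P = build x y z r"
    unfolding v_eq by (intro directed_plateaus_built)
  then show ?thesis using that by blast
qed

text \<open>
  A translation class contains exactly one polycube with root \<open>(0, 0, 0)\<close>, and this polycube has
  exactly one plan.
\<close>

lemma directed_plateau_count_weight: "directed_plateau_count n = card {r. weight r = n}"
proof -
  let ?A = "{P. directed_plateau_polycube P \<and> lateral_area P = n}"
  let ?f = "\<lambda>r. translation_rel `` {build 0 0 0 r}"
  \<comment> \<open>The right-hand side does not depend on the root, so each class has a representative rooted at \<open>0\<close>.\<close>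
  have cls: "translation_rel `` {build x y z r} = {build u v w r |u v w. True}" for x y z r
  proof (intro set_eqI iffI)
    fix Q assume "Q \<in> translation_rel `` {build x y z r}"
    then obtain t where "Q = (\<lambda>c. c + t) ` build x y z r"
      unfolding translation_rel_def by blast
    moreover obtain u v w where "t = (u, v, w)" by (rule prod_cases3)
    ultimately have "Q = build (x + u) (y + v) (z + w) r" by (simp only: translate_build)
    then show "Q \<in> {build u v w r |u v w. True}" by blast
  next
    fix Q assume "Q \<in> {build u v w r |u v w. True}"
    then obtain u v w where "Q = build u v w r" by blast
    then have "Q = (\<lambda>c. c + (u - x, v - y, w - z)) ` build x y z r"
      by (simp add: translate_build)
    then show "Q \<in> translation_rel `` {build x y z r}"
      unfolding translation_rel_def by blast
  qed
  have "?A // translation_rel = ?f ` {r. weight r = n}"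
  proof (intro set_eqI iffI)
    fix C assume "C \<in> ?A // translation_rel"
    then obtain P where P: "P \<in> ?A" "C = translation_rel `` {P}" by (rule quotientE)
    then obtain x y z r where "P = build x y z r"
      using directed_plateau_polycube_built[of P] by blast
    with P have "C = ?f r" "weight r = n" by (simp_all only: cls mem_Collect_eq lateral_area_build)
    then show "C \<in> ?f ` {r. weight r = n}" by blast
  next
    fix C assume "C \<in> ?f ` {r. weight r = n}"
    then show "C \<in> ?A // translation_rel"
    proof
      fix r assume "C = ?f r" and "r \<in> {r. weight r = n}"
      moreover from this have "build 0 0 0 r \<in> ?A"
        by (simp add: build_directed_plateau_polycube lateral_area_build)
      ultimately show ?thesis by (simp only: quotientI)
    qed
  qed
  moreover have "inj ?f"
  proof (rule injI)
    fix r r' assume "?f r = ?f r'"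
    moreover have "build 0 0 0 r \<in> ?f r" unfolding cls by blast
    ultimately have "build 0 0 0 r \<in> {build u v w r' |u v w. True}" by (simp only: cls)
    then obtain u v w where "build 0 0 0 r = build u v w r'" by blast
    then show "r = r'" using build_eq_corner[of 0 0 0 r u v w r'] build_inj[of 0 0 0 r r'] by simp
  qed
  then have "inj_on ?f {r. weight r = n}" by (rule inj_on_subset) simp
  ultimately show ?thesis unfolding directed_plateau_count_def by (simp only: card_image)
qed

section \<open>Counting by weight\<close>

text \<open>
  The ordinary generating function of a combinatorial class with weight \<open>w\<close>. It is meaningful
  only if the fibres of \<open>w\<close> are finite, since \<open>card\<close> sends infinite sets to \<open>0\<close>.
\<close>

definition counting_fps :: "('a \<Rightarrow> nat) \<Rightarrow> rat fps" where
  "counting_fps w = Abs_fps (\<lambda>n. of_nat (card {a. w a = n}))"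

definition finite_fibres :: "('a \<Rightarrow> nat) \<Rightarrow> bool" where
  "finite_fibres w \<longleftrightarrow> (\<forall>n. finite {a. w a = n})"

lemma prod_fibre:
  "{(a, b). w a + v b = (n::nat)} = (\<Union>i\<le>n. {a. w a = i} \<times> {b. v b = n - i})"
  by auto

lemma finite_fibres_prod:
  assumes "finite_fibres w" "finite_fibres v"
  shows "finite_fibres (\<lambda>(a, b). w a + v b)"
  unfolding finite_fibres_def
proof
  fix n
  have "finite {(a, b). w a + v b = n}"
    unfolding prod_fibre using assms by (auto simp: finite_fibres_def)
  then show "finite {c. (case c of (a, b) \<Rightarrow> w a + v b) = n}" by (simp add: split_def)
qed

lemma counting_fps_prod:
  assumes "finite_fibres w" "finite_fibres v"
  shows "counting_fps (\<lambda>(a, b). w a + v b) = counting_fps w * counting_fps v"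
proof (rule fps_ext)
  fix n
  have "card {(a, b). w a + v b = n} = (\<Sum>i\<le>n. card ({a. w a = i} \<times> {b. v b = n - i}))"
    unfolding prod_fibre using assms by (intro card_UN_disjoint) (auto simp: finite_fibres_def)
  then show "fps_nth (counting_fps (\<lambda>(a, b). w a + v b)) n = fps_nth (counting_fps w * counting_fps v) n"
    by (simp add: counting_fps_def fps_mult_nth card_cartesian_product split_def atLeast0AtMost)
qed

lemma counting_fps_shift: "counting_fps (\<lambda>a. w a + k) = fps_X ^ k * counting_fps w"
proof (rule fps_ext)
  fix n
  have "{a. w a + k = n} = (if n < k then {} else {a. w a = n - k})" by auto
  then show "fps_nth (counting_fps (\<lambda>a. w a + k)) n = fps_nth (fps_X ^ k * counting_fps w) n"
    by (simp add: counting_fps_def fps_X_power_mult_nth)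
qed

lemma finite_fibres_shift: "finite_fibres w \<Longrightarrow> finite_fibres (\<lambda>a. w a + k)"
  unfolding finite_fibres_def
proof
  fix n assume "\<forall>n. finite {a. w a = n}"
  moreover have "{a. w a + k = n} \<subseteq> {a. w a = n - k}" by auto
  ultimately show "finite {a. w a + k = n}" by (blast intro: finite_subset)
qed

lemma finite_fibres_id: "finite_fibres (\<lambda>m::nat. m)"
  by (simp add: finite_fibres_def)

lemma counting_fps_id: "counting_fps (\<lambda>m::nat. m) * (1 - fps_X) = 1"
  by (rule fps_ext) (simp add: counting_fps_def algebra_simps)

section \<open>The generating function of plans\<close>

definition pair_weight :: "nat \<times> nat \<Rightarrow> nat" where
  "pair_weight = (\<lambda>(a, b). a + b)"

text \<open>
  \<open>last_weight\<close> and \<open>step_weight\<close> are the weights of a single layer in the two positions, on the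
  arguments of \<open>Last\<close> and on the layer arguments of \<open>Then\<close>. Their generating functions are the
  series \<open>A\<close> and \<open>B\<close>.
\<close>

definition last_weight :: "nat \<times> nat \<Rightarrow> nat" where
  "last_weight c = pair_weight c + 2"

definition step_weight :: "(nat \<times> nat) \<times> (nat \<times> nat) \<Rightarrow> nat" where
  "step_weight c = (case c of (u, v) \<Rightarrow> pair_weight u + pair_weight v) + 2"

lemma finite_fibres_step: "finite_fibres step_weight"
  and finite_fibres_last: "finite_fibres last_weight"
  unfolding step_weight_def last_weight_def pair_weight_def
  by (intro finite_fibres_shift finite_fibres_prod finite_fibres_id)+

lemma counting_fps_last:
  "counting_fps last_weight = fps_X ^ 2 * counting_fps (\<lambda>m::nat. m) ^ 2"
  unfolding last_weight_def pair_weight_def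
  by (simp only: counting_fps_shift counting_fps_prod finite_fibres_id power2_eq_square)

lemma counting_fps_step:
  "counting_fps step_weight = fps_X ^ 2 * counting_fps (\<lambda>m::nat. m) ^ 4"
proof -
  have "finite_fibres pair_weight"
    unfolding pair_weight_def by (intro finite_fibres_prod finite_fibres_id)
  then have "counting_fps step_weight = fps_X ^ 2 * (counting_fps pair_weight * counting_fps pair_weight)"
    unfolding step_weight_def by (simp only: counting_fps_shift counting_fps_prod)
  also have "counting_fps pair_weight = counting_fps (\<lambda>m::nat. m) ^ 2"
    unfolding pair_weight_def by (simp only: counting_fps_prod finite_fibres_id power2_eq_square)
  finally show ?thesis by (simp flip: power_add)
qed

lemma weight_fibre:
  "{r. weight r = n} = (\<lambda>(m, n). Last m n) ` {c. last_weight c = n} \<union>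
     (\<lambda>(((p, p'), (q, q')), r). Then p p' q q' r) ` {(s, r). step_weight s + weight r = n}"
  (is "_ = ?L ` _ \<union> ?T ` _")
proof (intro set_eqI iffI)
  fix r assume "r \<in> {r. weight r = n}"
  then show "r \<in> ?L ` {c. last_weight c = n} \<union> ?T ` {(s, r). step_weight s + weight r = n}"
  proof (cases r)
    case (Last m k)
    then have "r = ?L (m, k)" "last_weight (m, k) = n"
      using \<open>r \<in> _\<close> by (simp_all add: last_weight_def pair_weight_def)
    then show ?thesis by blast
  next
    case (Then p p' q q' r')
    then have "r = ?T (((p, p'), (q, q')), r')" "step_weight ((p, p'), (q, q')) + weight r' = n"
      using \<open>r \<in> _\<close> by (simp_all add: step_weight_def pair_weight_def)
    then show ?thesis by blast
  qed
qed (auto simp: last_weight_def step_weight_def pair_weight_def)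

text \<open>A layer has positive weight, so \<open>Then\<close> strictly increases the weight.\<close>

lemma finite_fibres_weight: "finite_fibres weight"
  unfolding finite_fibres_def
proof
  fix n
  show "finite {r. weight r = n}"
  proof (induction n rule: less_induct)
    case (less n)
    have "{(s, r). step_weight s + weight r = n} \<subseteq>
        (\<Union>k<n. {s. step_weight s = n - k} \<times> {r. weight r = k})"
      by (auto simp: step_weight_def)
    moreover have "finite \<dots>"
      using less finite_fibres_step by (auto simp: finite_fibres_def)
    ultimately have "finite {(s, r). step_weight s + weight r = n}" by (rule finite_subset)
    then show ?case
      using finite_fibres_last unfolding weight_fibre[of n] by (auto simp: finite_fibres_def)
  qed
qed

text \<open>The equation \<open>S = A + B S\<close>: a plan is a last layer, or a layer followed by a plan.\<close>

lemma counting_fps_weight: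
  "counting_fps weight = counting_fps last_weight + counting_fps step_weight * counting_fps weight"
proof (rule fps_ext)
  fix n
  let ?W = "\<lambda>(s, r). step_weight s + weight r"
  let ?L = "\<lambda>(m, n). Last m n" and ?T = "\<lambda>(((p, p'), (q, q')), r). Then p p' q q' r"
  have fin: "finite {c. last_weight c = n}" "finite {c. ?W c = n}"
    using finite_fibres_last finite_fibres_prod[OF finite_fibres_step finite_fibres_weight]
    by (simp_all add: finite_fibres_def)
  have "inj ?L" "inj ?T" by (auto simp: inj_def)
  then have inj: "inj_on ?L A" "inj_on ?T B" for A B by (auto intro: inj_on_subset)
  have eq: "{(s, r). step_weight s + weight r = n} = {c. ?W c = n}" by auto
  have "card {r. weight r = n} = card (?L ` {c. last_weight c = n}) + card (?T ` {c. ?W c = n})"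
    unfolding weight_fibre[of n] eq using fin by (intro card_Un_disjoint) auto
  also have "\<dots> = card {c. last_weight c = n} + card {c. ?W c = n}"
    using inj by (simp add: card_image)
  finally have "fps_nth (counting_fps weight) n =
      fps_nth (counting_fps last_weight + counting_fps ?W) n"
    by (simp add: counting_fps_def)
  then show "fps_nth (counting_fps weight) n =
      fps_nth (counting_fps last_weight + counting_fps step_weight * counting_fps weight) n"
    by (simp only: counting_fps_prod[OF finite_fibres_step finite_fibres_weight])
qed

theorem theorem3p3:
  "directed_plateau_gf =
     fps_X ^ 2 * (1 - fps_X) ^ 2 / ((1 - fps_X) ^ 4 - fps_X ^ 2)"
proof -
  define S where "S = directed_plateau_gf"
  define G where "G = counting_fps (\<lambda>m::nat. m)"
  let ?Y = "1 - fps_X :: rat fps"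
  let ?D = "?Y ^ 4 - fps_X ^ 2"
  have "S = counting_fps weight"
    by (simp add: S_def directed_plateau_gf_def counting_fps_def directed_plateau_count_weight)
  then have S: "S = fps_X ^ 2 * G ^ 2 + fps_X ^ 2 * G ^ 4 * S"
    using counting_fps_weight by (simp add: counting_fps_last counting_fps_step G_def)
  have G: "G * ?Y = 1" unfolding G_def by (rule counting_fps_id)
  \<comment> \<open>Multiply \<open>S = A + B S\<close> by \<open>(1 - X)\<^sup>4\<close>, the common denominator of \<open>A\<close> and \<open>B\<close>.\<close>
  have "S * ?Y ^ 4 = (fps_X ^ 2 * G ^ 2 + fps_X ^ 2 * G ^ 4 * S) * ?Y ^ 4"
    using S by simp
  also have "\<dots> = fps_X ^ 2 * ((G * ?Y) ^ 2 * ?Y ^ 2) + fps_X ^ 2 * (G * ?Y) ^ 4 * S"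
    by (simp only: power_mult_distrib) (simp add: algebra_simps flip: power_add)
  also have "\<dots> = fps_X ^ 2 * ?Y ^ 2 + fps_X ^ 2 * S"
    by (simp add: G)
  finally have "S * ?D = fps_X ^ 2 * ?Y ^ 2"
    by (simp add: algebra_simps)
  moreover have "fps_nth ?D 0 \<noteq> 0" by simp
  then have "?D \<noteq> 0" by (metis fps_zero_nth)
  then have "S * ?D / ?D = S" by (rule nonzero_mult_div_cancel_right)
  ultimately show ?thesis by (simp only: S_def)
qed

end
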